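(* Suppose $V$ is a subgroup of $\mathcal{L}_n$. Then either $V$ is a subgroup of $\mathcal{A}_n$, or $V$ is isomorphic to $\mathcal{L}_k$ for some $k\in\mathbb{N}$. In particular, if $V$ is of finite index in $\mathcal{L}_n$, then $V$ is isomorphic to $\mathcal{L}_{ns}$, where $s\ge 1$ is the integer such that $s\mathbb{Z}$ is the image of the projection of $V$ onto $\mathbb{Z}$.
   Context: $p$ is a fixed prime, $n\ge 1$. $\mathcal{L}_n=(\mathbb{Z}/p\mathbb{Z})^n\wr\mathbb{Z}=\mathcal{A}_n\rtimes\mathbb{Z}$, where $\mathcal{A}_n=\bigoplus_{\mathbb{Z}}(\mathbb{Z}/p\mathbb{Z})^n$ and the generator of $\mathbb{Z}$ acts on $\mathcal{A}_n$ by the shift by one; $\mathcal{A}_n$ is regarded as a subgroup of $\mathcal{L}_n$. The projection is $\mathcal{L}_n\to\mathcal{L}_n/\mathcal{A}_n=\mathbb{Z}$. Here $\mathbb{N}$ contains $0$, and $\mathcal{L}_0=\mathbb{Z}$. *)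

theory Defs
  imports "HOL-Algebra.Product_Groups" "HOL-Computational_Algebra.Primes"
begin

definition semidirect_product ::
    "('a, 'm) monoid_scheme \<Rightarrow> ('b, 'n) monoid_scheme \<Rightarrow> ('b \<Rightarrow> 'a \<Rightarrow> 'a) \<Rightarrow> ('a \<times> 'b) monoid"
  where "semidirect_product N H \<phi> =
    \<lparr>carrier = carrier N \<times> carrier H,
     monoid.mult = (\<lambda>(a, g) (b, h). (a \<otimes>\<^bsub>N\<^esub> \<phi> g b, g \<otimes>\<^bsub>H\<^esub> h)),
     one = (\<one>\<^bsub>N\<^esub>, \<one>\<^bsub>H\<^esub>)\<rparr>"

definition lamp_group :: "nat \<Rightarrow> nat \<Rightarrow> (nat \<Rightarrow> int) monoid"
  where "lamp_group p n = product_group {..<n} (\<lambda>_. integer_mod_group p)"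

definition lamp_sum :: "nat \<Rightarrow> nat \<Rightarrow> (int \<Rightarrow> nat \<Rightarrow> int) monoid"
  where "lamp_sum p n = sum_group (UNIV :: int set) (\<lambda>_. lamp_group p n)"

definition shift :: "int \<Rightarrow> (int \<Rightarrow> 'a) \<Rightarrow> int \<Rightarrow> 'a"
  where "shift m a = (\<lambda>i. a (i - m))"

text \<open>The group \<open>\<L>\<^sub>n\<close>. As \<open>lamp_group p 0\<close> is trivial, \<open>lamplighter p 0\<close> is a copy of
  the integers, and \<open>k = 0\<close> needs no separate case: see \<open>lamplighter_0\<close> below.\<close>

definition lamplighter :: "nat \<Rightarrow> nat \<Rightarrow> ((int \<Rightarrow> nat \<Rightarrow> int) \<times> int) monoid"
  where "lamplighter p n = semidirect_product (lamp_sum p n) integer_group shift"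

text \<open>\<open>\<A>\<^sub>n\<close> as a subgroup of \<open>\<L>\<^sub>n\<close>. It is the kernel of \<open>snd\<close>, which is therefore
  the projection \<open>\<L>\<^sub>n \<rightarrow> \<L>\<^sub>n / \<A>\<^sub>n = \<int>\<close>.\<close>

definition lamp_subgroup :: "nat \<Rightarrow> nat \<Rightarrow> ((int \<Rightarrow> nat \<Rightarrow> int) \<times> int) set"
  where "lamp_subgroup p n = carrier (lamp_sum p n) \<times> {0}"

lemma group_lamp_group [simp]: "group (lamp_group p n)"
  by (simp add: lamp_group_def)

lemma group_lamp_sum [simp]: "group (lamp_sum p n)"
  by (simp add: lamp_sum_def)

lemma carrier_lamp_sum:
  "carrier (lamp_sum p n) =
     {a. (\<forall>i. a i \<in> carrier (lamp_group p n)) \<and> finite {i. a i \<noteq> \<one>\<^bsub>lamp_group p n\<^esub>}}"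
  by (auto simp: lamp_sum_def carrier_sum_group PiE_iff)

lemma mult_lamp_sum: "a \<otimes>\<^bsub>lamp_sum p n\<^esub> b = (\<lambda>i. a i \<otimes>\<^bsub>lamp_group p n\<^esub> b i)"
  by (simp add: lamp_sum_def restrict_def)

lemma one_lamp_sum: "\<one>\<^bsub>lamp_sum p n\<^esub> = (\<lambda>i. \<one>\<^bsub>lamp_group p n\<^esub>)"
  by (simp add: lamp_sum_def restrict_def)

lemma shift_in_lamp_sum:
  assumes "a \<in> carrier (lamp_sum p n)"
  shows "shift m a \<in> carrier (lamp_sum p n)"
proof -
  have "{i. a (i - m) \<noteq> \<one>\<^bsub>lamp_group p n\<^esub>} = (\<lambda>i. i + m) ` {i. a i \<noteq> \<one>\<^bsub>lamp_group p n\<^esub>}"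
    by (auto simp: image_iff) (metis diff_add_cancel)
  then show ?thesis
    using assms by (simp add: carrier_lamp_sum shift_def)
qed

lemma carrier_lamplighter: "carrier (lamplighter p n) = carrier (lamp_sum p n) \<times> UNIV"
  by (simp add: lamplighter_def semidirect_product_def)

lemma mult_lamplighter:
  "(a, g) \<otimes>\<^bsub>lamplighter p n\<^esub> (b, h) = (a \<otimes>\<^bsub>lamp_sum p n\<^esub> shift g b, g + h)"
  by (simp add: lamplighter_def semidirect_product_def)

lemma one_lamplighter: "\<one>\<^bsub>lamplighter p n\<^esub> = (\<one>\<^bsub>lamp_sum p n\<^esub>, 0)"
  by (simp add: lamplighter_def semidirect_product_def)

lemma group_lamplighter [simp]: "group (lamplighter p n)"
proof (rule groupI)
  interpret A: group "lamp_sum p n" by simp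
  have shift_mult: "shift m (a \<otimes>\<^bsub>lamp_sum p n\<^esub> b) = shift m a \<otimes>\<^bsub>lamp_sum p n\<^esub> shift m b"
    and shift_one: "shift m \<one>\<^bsub>lamp_sum p n\<^esub> = \<one>\<^bsub>lamp_sum p n\<^esub>" for m a b
    by (simp_all add: shift_def mult_lamp_sum one_lamp_sum)
  have shift_shift: "shift k (shift m a) = shift (k + m) a" and shift_0: "shift 0 a = a"
    for k m and a :: "int \<Rightarrow> nat \<Rightarrow> int"
    by (simp_all add: shift_def algebra_simps)
  show "x \<otimes>\<^bsub>lamplighter p n\<^esub> y \<in> carrier (lamplighter p n)"
    if "x \<in> carrier (lamplighter p n)" "y \<in> carrier (lamplighter p n)" for x y
    using that by (cases x; cases y)
      (simp add: carrier_lamplighter mult_lamplighter shift_in_lamp_sum)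
  show "\<one>\<^bsub>lamplighter p n\<^esub> \<in> carrier (lamplighter p n)"
    by (simp add: carrier_lamplighter one_lamplighter)
  show "x \<otimes>\<^bsub>lamplighter p n\<^esub> y \<otimes>\<^bsub>lamplighter p n\<^esub> z
      = x \<otimes>\<^bsub>lamplighter p n\<^esub> (y \<otimes>\<^bsub>lamplighter p n\<^esub> z)"
    if "x \<in> carrier (lamplighter p n)" "y \<in> carrier (lamplighter p n)"
      "z \<in> carrier (lamplighter p n)" for x y z
    using that by (cases x; cases y; cases z)
      (simp add: carrier_lamplighter mult_lamplighter shift_in_lamp_sum shift_mult
        shift_shift A.m_assoc)
  show "\<one>\<^bsub>lamplighter p n\<^esub> \<otimes>\<^bsub>lamplighter p n\<^esub> x = x"
    if "x \<in> carrier (lamplighter p n)" for x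
    using that by (cases x)
      (simp add: carrier_lamplighter mult_lamplighter one_lamplighter shift_0)
  show "\<exists>y\<in>carrier (lamplighter p n). y \<otimes>\<^bsub>lamplighter p n\<^esub> x = \<one>\<^bsub>lamplighter p n\<^esub>"
    if "x \<in> carrier (lamplighter p n)" for x
  proof (cases x)
    case (Pair a g)
    have "inv\<^bsub>lamp_sum p n\<^esub> (shift (-g) a) \<in> carrier (lamp_sum p n)"
      and "inv\<^bsub>lamp_sum p n\<^esub> (shift (-g) a) \<otimes>\<^bsub>lamp_sum p n\<^esub> shift (-g) a = \<one>\<^bsub>lamp_sum p n\<^esub>"
      using that Pair by (simp_all add: carrier_lamplighter shift_in_lamp_sum)
    then show ?thesis
      using Pair by (intro bexI [of _ "(inv\<^bsub>lamp_sum p n\<^esub> (shift (-g) a), -g)"])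
        (simp_all add: carrier_lamplighter mult_lamplighter one_lamplighter)
  qed
qed

lemma snd_epi_lamplighter: "snd \<in> epi (lamplighter p n) integer_group"
proof -
  have "(\<one>\<^bsub>lamp_sum p n\<^esub>, m) \<in> carrier (lamplighter p n)" for m
    by (simp add: carrier_lamplighter group.is_monoid monoid.one_closed)
  moreover have "snd (x \<otimes>\<^bsub>lamplighter p n\<^esub> y) = snd x + snd y" for x y
    by (cases x; cases y) (simp add: mult_lamplighter)
  ultimately show ?thesis
    by (force simp: epi_def hom_def)
qed

lemma kernel_snd_lamplighter: "kernel (lamplighter p n) integer_group snd = lamp_subgroup p n"
  by (auto simp: kernel_def carrier_lamplighter lamp_subgroup_def)

lemma lamplighter_0: "lamplighter p 0 \<cong> integer_group"
proof -
  have "carrier (lamp_sum p 0) = {\<lambda>_ _. undefined}"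
    by (auto simp: carrier_lamp_sum lamp_group_def restrict_def)
  then have "inj_on snd (carrier (lamplighter p 0))"
    by (auto simp: carrier_lamplighter inj_on_def)
  then show ?thesis
    using snd_epi_lamplighter [of p 0]
    by (intro is_isoI [of snd]) (auto simp: iso_iff_mon_epi mon_def epi_def)
qed

end

theory Submission
  imports Defs "HOL-Library.Poly_Mapping" "HOL-Computational_Algebra.Polynomial"
begin

text \<open>Let \<open>s\<int>\<close> be the image of \<open>V\<close> in \<open>\<int>\<close>. If \<open>s > 0\<close>, choose \<open>v\<close> in \<open>V\<close> above \<open>s\<close>. Conjugation
  by \<open>v\<close> is the shift by \<open>s\<close> on \<open>\<A>\<^sub>n\<close>, so \<open>V \<inter> \<A>\<^sub>n\<close> is a submodule of \<open>\<A>\<^sub>n\<close> over the principal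
  ideal domain of Laurent polynomials in \<open>t^s\<close> with coefficients in \<open>\<int>/p\<int>\<close>. Over this ring \<open>\<A>\<^sub>n\<close>
  is free of rank \<open>n s\<close>; hence \<open>V \<inter> \<A>\<^sub>n\<close> is free of some rank \<open>k \<le> n s\<close>, and \<open>V\<close>, the semidirect
  product of \<open>V \<inter> \<A>\<^sub>n\<close> and the powers of \<open>v\<close>, is a copy of \<open>\<L>\<^sub>k\<close>. If \<open>V\<close> has finite index, then by
  the pigeonhole principle it contains a nonzero multiple of each basis vector of \<open>\<A>\<^sub>n\<close>, so
  \<open>k = n s\<close>.

  Since \<open>p\<close> is not fixed by a type, the ring is replaced by the Laurent polynomials over \<open>\<int>\<close>,
  which are the type \<open>int \<Rightarrow>\<^sub>0 int\<close> with \<open>t^m = frag_of m\<close>, and everything is stated modulo \<open>p\<close>.\<close>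

subsection \<open>Submodules of free modules modulo a prime\<close>

text \<open>Induction on the rank through the last coordinate, as for submodules of free modules
  over a principal ideal domain; the quotient by \<open>P\<close> takes the place of that domain. As
  \<open>U\<close> contains every vector that vanishes modulo \<open>P\<close>, it stands for a
  submodule of the quotient. The last clause recovers the full rank when \<open>U\<close> meets each
  coordinate axis nontrivially modulo \<open>P\<close>.\<close>

lemma submodule_basis_mod:
  fixes P :: "'a::comm_ring_1" and U :: "(nat \<Rightarrow> 'a) set"
  assumes prime: "\<And>x y. P dvd x * y \<Longrightarrow> P dvd x \<or> P dvd y"
    and principal: "\<And>I. P \<in> I \<Longrightarrow> (\<And>x y. x \<in> I \<Longrightarrow> y \<in> I \<Longrightarrow> x + y \<in> I) \<Longrightarrow>
      (\<And>c x. x \<in> I \<Longrightarrow> c * x \<in> I) \<Longrightarrow> \<exists>g\<in>I. \<forall>x\<in>I. \<exists>h. P dvd x - h * g"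
    and U_mod: "\<And>F. \<forall>j<N. P dvd F j \<Longrightarrow> F \<in> U"
    and U_add: "\<And>F G. F \<in> U \<Longrightarrow> G \<in> U \<Longrightarrow> (\<lambda>j. F j + G j) \<in> U"
    and U_scale: "\<And>c F. F \<in> U \<Longrightarrow> (\<lambda>j. c * F j) \<in> U"
  shows "\<exists>k w. k \<le> N \<and> (\<forall>l<k. w l \<in> U) \<and>
    (\<forall>F\<in>U. \<exists>C. \<forall>j<N. P dvd F j - (\<Sum>l<k. C l * w l j)) \<and>
    (\<forall>C. (\<forall>j<N. P dvd (\<Sum>l<k. C l * w l j)) \<longrightarrow> (\<forall>l<k. P dvd C l)) \<and>
    ((\<forall>i<N. \<exists>F\<in>U. \<not> P dvd F i \<and> (\<forall>j<N. j \<noteq> i \<longrightarrow> P dvd F j)) \<longrightarrow> k = N)"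
    (is "?basis N U")
  using U_mod U_add U_scale
proof (induction N arbitrary: U)
  case 0
  then show ?case
    by (intro exI [of _ 0]) simp
next
  case (Suc N)
  have cong_U: "G \<in> U" if "F \<in> U" "\<forall>j<Suc N. P dvd G j - F j" for F G
    using Suc.prems(2) [OF that(1) Suc.prems(1) [OF that(2)]] by simp
  \<comment> \<open>The vectors of \<open>U\<close> with last coordinate zero, viewed in rank
    \<open>N\<close>. Overwriting entry \<open>N\<close> leaves that entry of \<open>F\<close> free,
    since the closure condition in rank \<open>N\<close> only looks at entries below
    \<open>N\<close>.\<close>
  define U' where "U' = {F. F(N := 0) \<in> U}"
  have U'_mod: "F \<in> U'" if "\<forall>j<N. P dvd F j" for F
    unfolding U'_def using that by (auto intro!: Suc.prems(1) simp: less_Suc_eq)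
  have U'_add: "(\<lambda>j. F j + G j) \<in> U'" if "F \<in> U'" "G \<in> U'" for F G
  proof -
    have "(\<lambda>j. F j + G j)(N := 0) = (\<lambda>j. (F(N := 0)) j + (G(N := 0)) j)"
      by auto
    also have "\<dots> \<in> U"
      by (rule Suc.prems(2)) (use that in \<open>simp_all only: U'_def mem_Collect_eq\<close>)
    finally show ?thesis
      by (simp only: U'_def mem_Collect_eq)
  qed
  have U'_scale: "(\<lambda>j. c * F j) \<in> U'" if "F \<in> U'" for c F
  proof -
    have "(\<lambda>j. c * F j)(N := 0) = (\<lambda>j. c * (F(N := 0)) j)"
      by auto
    also have "\<dots> \<in> U"
      by (rule Suc.prems(3)) (use that in \<open>simp only: U'_def mem_Collect_eq\<close>)
    finally show ?thesis
      by (simp only: U'_def mem_Collect_eq)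
  qed
  have "?basis N U'"
    by (rule Suc.IH) (fact U'_mod U'_add U'_scale)+
  then obtain k w where kw: "k \<le> N" "\<forall>l<k. w l \<in> U'"
    "\<forall>F\<in>U'. \<exists>C. \<forall>j<N. P dvd F j - (\<Sum>l<k. C l * w l j)"
    "\<forall>C. (\<forall>j<N. P dvd (\<Sum>l<k. C l * w l j)) \<longrightarrow> (\<forall>l<k. P dvd C l)"
    "(\<forall>i<N. \<exists>F\<in>U'. \<not> P dvd F i \<and> (\<forall>j<N. j \<noteq> i \<longrightarrow> P dvd F j)) \<longrightarrow> k = N"
    by (elim exE conjE) (rule that)
  have U'I: "F \<in> U'" if "F \<in> U" "P dvd F N" for F
    unfolding U'_def using that by (auto intro!: cong_U [OF that(1)] simp: less_Suc_eq)
  define I where "I = (\<lambda>F. F N) ` U"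
  have "\<exists>g\<in>I. \<forall>x\<in>I. \<exists>h. P dvd x - h * g"
  proof (rule principal)
    have "(\<lambda>_. P) \<in> U" by (rule Suc.prems(1)) simp
    then show "P \<in> I" by (force simp: I_def)
    show "x + y \<in> I" if "x \<in> I" "y \<in> I" for x y
      using that Suc.prems(2) by (force simp: I_def)
    show "c * x \<in> I" if "x \<in> I" for c x
      using that Suc.prems(3) by (force simp: I_def)
  qed
  then obtain f where f: "f \<in> U" and gen: "\<And>F. F \<in> U \<Longrightarrow> \<exists>h. P dvd F N - h * f N"
    by (auto simp: I_def)
  show ?case
  proof (cases "P dvd f N")
    \<comment> \<open>Every vector of \<open>U\<close> now has last entry zero modulo
      \<open>P\<close>, so the basis of \<open>U'\<close> serves for \<open>U\<close>, and the
      clause on full rank holds vacuously.\<close>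
    case True
    have N_dvd: "P dvd F N" if F: "F \<in> U" for F
    proof -
      obtain h where "P dvd F N - h * f N"
        using gen [OF F] by blast
      then have "P dvd (F N - h * f N) + h * f N"
        using True by (intro dvd_add) simp_all
      then show ?thesis by simp
    qed
    define w' where "w' = (\<lambda>l. (w l)(N := 0))"
    have "\<exists>C. \<forall>j<Suc N. P dvd F j - (\<Sum>l<k. C l * w' l j)" if F: "F \<in> U" for F
    proof -
      obtain C where "\<forall>j<N. P dvd F j - (\<Sum>l<k. C l * w l j)"
        using kw(3) U'I [OF F N_dvd [OF F]] by blast
      then show ?thesis
        using N_dvd [OF F] by (intro exI [of _ C]) (auto simp: less_Suc_eq w'_def)
    qed
    moreover have "\<forall>l<k. P dvd C l" if "\<forall>j<Suc N. P dvd (\<Sum>l<k. C l * w' l j)" for C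
      using that kw(4) by (auto simp: less_Suc_eq w'_def)
    moreover have "\<forall>l<k. w' l \<in> U"
      using kw(2) by (auto simp: w'_def U'_def)
    ultimately show ?thesis
      using kw(1) N_dvd by (intro exI [of _ k] exI [of _ w']) (auto simp: le_Suc_eq)
  next
    case False
    \<comment> \<open>The vector \<open>f\<close>, whose last entry generates \<open>I\<close>
      modulo \<open>P\<close>, joins the basis in position \<open>k\<close>.\<close>
    define w' where "w' = (\<lambda>l. if l < k then (w l)(N := 0) else f)"
    have sum_w': "(\<Sum>l<Suc k. C l * w' l j)
        = (if j = N then 0 else \<Sum>l<k. C l * w l j) + C k * f j" for C j
      by (auto simp: w'_def)
    have span: "\<forall>F\<in>U. \<exists>C. \<forall>j<Suc N. P dvd F j - (\<Sum>l<Suc k. C l * w' l j)"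
    proof
      fix F assume F: "F \<in> U"
      obtain h where h: "P dvd F N - h * f N"
        using gen [OF F] by blast
      \<comment> \<open>Subtracting \<open>h\<close> times \<open>f\<close> kills the last entry
        modulo \<open>P\<close>, and the remainder is spanned by the old basis.\<close>
      have F': "(\<lambda>j. F j + - h * f j) \<in> U'"
        by (rule U'I [OF Suc.prems(2) [OF F Suc.prems(3) [OF f]]]) (use h in simp)
      obtain C where C: "\<forall>j<N. P dvd F j + - h * f j - (\<Sum>l<k. C l * w l j)"
        using bspec [OF kw(3) F'] by (rule exE)
      have "(\<Sum>l<k. (if l = k then h else C l) * w l j) = (\<Sum>l<k. C l * w l j)" for j
        by (rule sum.cong) auto
      then show "\<exists>C. \<forall>j<Suc N. P dvd F j - (\<Sum>l<Suc k. C l * w' l j)"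
        using C h by (intro exI [of _ "\<lambda>l. if l = k then h else C l"])
          (auto simp: sum_w' less_Suc_eq diff_diff_eq add.commute simp del: sum.lessThan_Suc)
    qed
    have indep: "\<forall>C. (\<forall>j<Suc N. P dvd (\<Sum>l<Suc k. C l * w' l j)) \<longrightarrow> (\<forall>l<Suc k. P dvd C l)"
    proof (intro allI impI)
      fix C l assume C: "\<forall>j<Suc N. P dvd (\<Sum>l<Suc k. C l * w' l j)" and l: "l < Suc k"
      \<comment> \<open>Only \<open>f\<close> contributes to coordinate \<open>N\<close>; primality
        then forces \<open>C k\<close> to vanish, and the old basis takes care of the other
        coefficients.\<close>
      have "P dvd C k * f N"
        using C [rule_format, of N] unfolding sum_w' by simp
      then have k: "P dvd C k"
        using False prime by blast
      have "P dvd (\<Sum>l<k. C l * w l j)" if "j < N" for j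
      proof -
        have "P dvd (\<Sum>l<k. C l * w l j) + C k * f j"
          using C [rule_format, of j] that unfolding sum_w' by simp
        then show ?thesis
          using k by (simp add: dvd_add_left_iff)
      qed
      then have "\<forall>l<k. P dvd C l"
        using kw(4) by simp
      then show "P dvd C l"
        using l k by (auto simp: less_Suc_eq)
    qed
    have w'_U: "\<forall>l<Suc k. w' l \<in> U"
      using kw(2) f by (auto simp: w'_def U'_def)
    have full: "(\<forall>i<Suc N. \<exists>F\<in>U. \<not> P dvd F i \<and> (\<forall>j<Suc N. j \<noteq> i \<longrightarrow> P dvd F j))
        \<longrightarrow> Suc k = Suc N"
    proof
      assume full: "\<forall>i<Suc N. \<exists>F\<in>U. \<not> P dvd F i \<and> (\<forall>j<Suc N. j \<noteq> i \<longrightarrow> P dvd F j)"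
      \<comment> \<open>An axis vector for \<open>i < N\<close> has last entry zero modulo
        \<open>P\<close>, hence lies in \<open>U'\<close>.\<close>
      have "\<forall>i<N. \<exists>F\<in>U'. \<not> P dvd F i \<and> (\<forall>j<N. j \<noteq> i \<longrightarrow> P dvd F j)"
      proof (intro allI impI)
        fix i assume "i < N"
        then obtain F where "F \<in> U" "\<not> P dvd F i" "\<And>j. j < Suc N \<Longrightarrow> j \<noteq> i \<Longrightarrow> P dvd F j"
          using full [rule_format, of i] by auto
        then show "\<exists>F\<in>U'. \<not> P dvd F i \<and> (\<forall>j<N. j \<noteq> i \<longrightarrow> P dvd F j)"
          using U'I [of F] \<open>i < N\<close> by (intro bexI [of _ F]) auto
      qed
      then show "Suc k = Suc N"
        by (intro arg_cong [where f = Suc] mp [OF kw(5)])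
    qed
    have "Suc k \<le> Suc N"
      using kw(1) by simp
    then show ?thesis
      using w'_U span indep full by (intro exI [of _ "Suc k"], intro exI [of _ w'], intro conjI)
  qed
qed

subsection \<open>Laurent polynomials modulo a prime\<close>

lemma of_nat_dvd_poly_mapping_iff:
  fixes f :: "int \<Rightarrow>\<^sub>0 int"
  shows "of_nat p dvd f \<longleftrightarrow> (\<forall>i. int p dvd Poly_Mapping.lookup f i)"
proof -
  have mult: "of_nat p * g = Poly_Mapping.map ((*) (int p)) g" for g :: "int \<Rightarrow>\<^sub>0 int"
    by (simp add: mult_map_scale_conv_mult)
  show ?thesis
  proof
    assume "of_nat p dvd f"
    then show "\<forall>i. int p dvd Poly_Mapping.lookup f i"
      by (auto simp: mult Poly_Mapping.map.rep_eq when_def elim!: dvdE)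
  next
    assume "\<forall>i. int p dvd Poly_Mapping.lookup f i"
    then have "f = of_nat p * Poly_Mapping.map (\<lambda>x. x div int p) f"
      unfolding mult
      by (intro poly_mapping_eqI) (auto simp: Poly_Mapping.map.rep_eq when_def dvd_div_eq_0_iff)
    then show "of_nat p dvd f"
      by (rule dvdI)
  qed
qed

text \<open>Laurent polynomials are generated by the powers of t under subtraction, so signs and
  integer coefficients need no case of their own.\<close>

lemmas frag_induct = frag_induction [where S = UNIV, OF subset_UNIV,
    case_names zero one diff]

lemma lookup_frag_of_times:
  fixes f :: "int \<Rightarrow>\<^sub>0 int"
  shows "Poly_Mapping.lookup (frag_of m * f) i = Poly_Mapping.lookup f (i - m)"
proof (induction f rule: frag_induct)
  case (one k)
  then show ?case by (auto simp: mult_single lookup_single when_def)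
next
  case (diff f g)
  then show ?case by (simp add: right_diff_distrib lookup_minus)
qed simp_all

text \<open>The embedding of Z[t] into Z[t, t^-1], as evaluation at t. Primality and principal
  ideals are transferred along it.\<close>

definition laurent_of_poly :: "int poly \<Rightarrow> int \<Rightarrow>\<^sub>0 int"
  where "laurent_of_poly q = poly (map_poly of_int q) (frag_of 1)"

lemma laurent_of_poly_pCons:
  "laurent_of_poly (pCons a q) = of_int a + frag_of 1 * laurent_of_poly q"
  by (simp add: laurent_of_poly_def map_poly_pCons)

lemma laurent_of_poly_0 [simp]: "laurent_of_poly 0 = 0"
  by (simp add: laurent_of_poly_def)

lemma laurent_of_poly_add: "laurent_of_poly (q + r) = laurent_of_poly q + laurent_of_poly r"
  by (induction q r rule: poly_induct2) (simp_all add: laurent_of_poly_pCons algebra_simps)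

lemma laurent_of_poly_smult: "laurent_of_poly (smult c q) = of_int c * laurent_of_poly q"
  by (induction q) (simp_all add: laurent_of_poly_pCons algebra_simps)

lemma laurent_of_poly_mult: "laurent_of_poly (q * r) = laurent_of_poly q * laurent_of_poly r"
  by (induction q)
    (simp_all add: laurent_of_poly_pCons laurent_of_poly_add laurent_of_poly_smult algebra_simps)

lemma laurent_of_poly_monom: "laurent_of_poly (monom c n) = of_int c * frag_of (int n)"
  by (induction n) (simp_all add: monom_0 monom_Suc laurent_of_poly_pCons mult_single ac_simps
      flip: single_of_int)

lemma lookup_laurent_of_poly:
  "Poly_Mapping.lookup (laurent_of_poly q) i = (if i < 0 then 0 else poly.coeff q (nat i))"
proof (induction q arbitrary: i)
  case (pCons a q)
  show ?case
    by (auto simp: laurent_of_poly_pCons lookup_add lookup_frag_of_times pCons.IH lookup_of_int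
        when_def coeff_pCons nat_diff_distrib split: nat.split)
qed simp

lemma laurent_of_poly_dvd_iff: "of_nat p dvd laurent_of_poly q \<longleftrightarrow> [:int p:] dvd q"
proof -
  have "(\<forall>i. int p dvd Poly_Mapping.lookup (laurent_of_poly q) i)
      \<longleftrightarrow> (\<forall>n. int p dvd poly.coeff q n)"
  proof
    assume *: "\<forall>i. int p dvd Poly_Mapping.lookup (laurent_of_poly q) i"
    show "\<forall>n. int p dvd poly.coeff q n"
    proof
      show "int p dvd poly.coeff q n" for n
        using * [rule_format, of "int n"] by (simp add: lookup_laurent_of_poly)
    qed
  qed (simp add: lookup_laurent_of_poly)
  then show ?thesis
    by (simp add: of_nat_dvd_poly_mapping_iff const_poly_dvd_iff)
qed

text \<open>Clearing denominators: a large power of t moves all exponents to the nonnegative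
  side.\<close>

lemma laurent_of_poly_shifted:
  obtains d q where "frag_of (int d) * f = laurent_of_poly q"
proof -
  have "\<exists>d q. frag_of (int d) * f = laurent_of_poly q"
  proof (induction f rule: frag_induct)
    case zero
    then show ?case
      by (intro exI [of _ 0] exI [of _ 0]) simp
  next
    case (one k)
    \<comment> \<open>The truncation in \<open>nat\<close> treats both signs at once: the shift is
      max(0, -k) and the resulting exponent max(0, k).\<close>
    have "frag_of (int (nat (- k))) * frag_of k = laurent_of_poly (monom 1 (nat k))"
      by (simp add: laurent_of_poly_monom mult_single)
    then show ?case by blast
  next
    case (diff f g)
    then obtain d q e r where eq: "frag_of (int d) * f = laurent_of_poly q"
      "frag_of (int e) * g = laurent_of_poly r"
      by blast
    \<comment> \<open>Each polynomial is multiplied by the shift of the other, which gives the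
      common shift \<open>d + e\<close>.\<close>
    have "laurent_of_poly (monom 1 e * q + monom (-1) d * r)
      = frag_of (int e) * (frag_of (int d) * f)
        - frag_of (int d) * (frag_of (int e) * g)"
      by (simp add: laurent_of_poly_add laurent_of_poly_mult laurent_of_poly_monom eq)
    also have "\<dots> = frag_of (int (d + e)) * (f - g)"
      by (simp add: mult_single right_diff_distrib add.commute flip: mult.assoc)
    finally show ?case
      by metis
  qed
  then show thesis
    using that by blast
qed

text \<open>Powers of t are units.\<close>

lemma dvd_single_times_iff:
  fixes f :: "int \<Rightarrow>\<^sub>0 int"
  shows "x dvd frag_of m * f \<longleftrightarrow> x dvd f"
proof
  have "f = frag_of (- m) * (frag_of m * f)"
    by (simp add: mult_single flip: mult.assoc)
  then show "x dvd f" if "x dvd frag_of m * f"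
    using that by (metis dvd_mult)
qed simp

text \<open>Up to units both factors lie in Z[t], where the constant \<open>p\<close> is a prime
  element.\<close>

lemma laurent_prime_dvd_mult:
  fixes f g :: "int \<Rightarrow>\<^sub>0 int"
  assumes "Factorial_Ring.prime p" and "of_nat p dvd f * g"
  shows "of_nat p dvd f \<or> of_nat p dvd g"
proof -
  obtain d q where f: "frag_of (int d) * f = laurent_of_poly q"
    by (rule laurent_of_poly_shifted)
  obtain e r where g: "frag_of (int e) * g = laurent_of_poly r"
    by (rule laurent_of_poly_shifted)
  have "laurent_of_poly (q * r)
      = frag_of (int d) * (frag_of (int e) * (f * g))"
    by (simp add: laurent_of_poly_mult ac_simps flip: f g)
  then have "[:int p:] dvd q * r"
    using assms(2) by (simp add: dvd_single_times_iff flip: laurent_of_poly_dvd_iff)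
  then have "[:int p:] dvd q \<or> [:int p:] dvd r"
    using assms(1) by (intro prime_elem_dvd_multD) (auto simp: prime_elem_const_poly_iff)
  then show ?thesis
    by (simp add: dvd_single_times_iff flip: laurent_of_poly_dvd_iff f g)
qed

text \<open>An element of least degree among the polynomials in \<open>J\<close> that are nonzero modulo \<open>p\<close>
  can be made monic, so division by it is possible over the integers.\<close>

lemma int_poly_ideal_principal_mod:
  fixes J :: "int poly set"
  assumes p: "Factorial_Ring.prime p" and J_p: "[:int p:] \<in> J"
    and J_add: "\<And>q r. q \<in> J \<Longrightarrow> r \<in> J \<Longrightarrow> q + r \<in> J"
    and J_mult: "\<And>c q. q \<in> J \<Longrightarrow> c * q \<in> J"
  shows "\<exists>g\<in>J. \<forall>q\<in>J. \<exists>h. [:int p:] dvd q - h * g"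
proof (cases "\<forall>q\<in>J. [:int p:] dvd q")
  case True
  then show ?thesis
    using J_p by (intro bexI [of _ "[:int p:]"] ballI exI [of _ 0]) simp_all
next
  case False
  have J_dvd: "q \<in> J" if "[:int p:] dvd q" for q
    using that J_mult [OF J_p] by (metis dvdE mult.commute)
  obtain q where q: "q \<in> J" "\<not> [:int p:] dvd q"
    and min: "\<And>r. r \<in> J \<Longrightarrow> \<not> [:int p:] dvd r \<Longrightarrow> degree q \<le> degree r"
    using False exists_least_iff [of "\<lambda>d. \<exists>q\<in>J. \<not> [:int p:] dvd q \<and> degree q = d"]
    by (metis not_le)
  \<comment> \<open>Otherwise dropping the leading term would leave an element of \<open>J\<close>
    of smaller degree, still nonzero modulo \<open>p\<close>.\<close>
  have "\<not> int p dvd lead_coeff q"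
  proof
    assume lc: "int p dvd lead_coeff q"
    have monom: "[:int p:] dvd monom (lead_coeff q) (degree q)"
      using lc by (simp add: const_poly_dvd_iff)
    define r where "r = q + - monom (lead_coeff q) (degree q)"
    have "r \<in> J"
      unfolding r_def using monom by (intro J_add q(1) J_dvd) simp
    moreover have r: "\<not> [:int p:] dvd r"
      using q(2) monom by (simp add: r_def dvd_diff_left_iff)
    ultimately have "degree q \<le> degree r"
      by (rule min)
    moreover have "degree r \<le> degree q" "poly.coeff r (degree q) = 0"
      by (auto simp: r_def degree_monom_le intro!: degree_diff_le)
    ultimately have "r = 0"
      using eq_zero_or_degree_less by fastforce
    then show False using r by simp
  qed
  then have "coprime (lead_coeff q) (int p)"
    using p by (simp add: prime_imp_coprime coprime_commute)
  then obtain u v where "u * lead_coeff q + v * int p = 1"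
    using bezout_int [of "lead_coeff q" "int p"] by auto
  then have u: "int p dvd lead_coeff q * u - 1"
    by (intro dvdI [of _ _ "- v"]) (simp add: algebra_simps)
  \<comment> \<open>Scaling by \<open>u\<close>, an inverse of the leading coefficient modulo
    \<open>p\<close>, makes that coefficient 1 modulo \<open>p\<close>. The subtracted monomial is a
    multiple of \<open>p\<close>, hence in \<open>J\<close>, and makes the coefficient exactly
    1.\<close>
  define g where "g = [:u:] * q + - monom (lead_coeff q * u - 1) (degree q)"
  have g_J: "g \<in> J"
    unfolding g_def using u by (intro J_add J_mult q(1) J_dvd) (simp add: const_poly_dvd_iff)
  have deg: "degree g \<le> degree q"
    by (auto simp: g_def degree_monom_le degree_smult_le intro!: degree_diff_le)
  have "poly.coeff g (degree q) = 1"
    by (simp add: g_def)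
  then have "degree q \<le> degree g"
    by (intro le_degree) simp
  with deg have monic: "degree g = degree q" "lead_coeff g = 1"
    using \<open>poly.coeff g (degree q) = 1\<close> by simp_all
  then have "g \<noteq> 0"
    by auto
  have "\<exists>h. [:int p:] dvd f - h * g" if "f \<in> J" for f
  proof -
    \<comment> \<open>Since \<open>g\<close> is monic, the scaling factor of pseudo-division is 1
      and this is division with remainder.\<close>
    obtain h r where hr: "pseudo_divmod f g = (h, r)"
      by fastforce
    have eq: "f = g * h + r" and r: "r = 0 \<or> degree r < degree g"
      using pseudo_divmod [OF \<open>g \<noteq> 0\<close> hr] monic(2) by simp_all
    have "r = f + (- h) * g"
      using eq by simp
    then have "r \<in> J"
      using J_add J_mult that g_J by metis
    \<comment> \<open>The remainder has smaller degree than \<open>q\<close>, so minimality makes it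
      zero modulo \<open>p\<close>.\<close>
    then have "[:int p:] dvd r"
      using r min monic(1) by fastforce
    then show ?thesis
      using eq by (intro exI [of _ h]) (simp add: mult.commute)
  qed
  then show ?thesis
    using g_J by blast
qed

text \<open>A generator of the part of \<open>I\<close> in Z[t] generates \<open>I\<close> as well,
  because each element of \<open>I\<close> enters that part after multiplication by a unit.\<close>

lemma laurent_ideal_principal_mod:
  fixes I :: "(int \<Rightarrow>\<^sub>0 int) set"
  assumes p: "Factorial_Ring.prime p" and I_p: "of_nat p \<in> I"
    and I_add: "\<And>x y. x \<in> I \<Longrightarrow> y \<in> I \<Longrightarrow> x + y \<in> I"
    and I_mult: "\<And>c x. x \<in> I \<Longrightarrow> c * x \<in> I"
  shows "\<exists>g\<in>I. \<forall>x\<in>I. \<exists>h. of_nat p dvd x - h * g"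
proof -
  define J where "J = {q. laurent_of_poly q \<in> I}"
  have "\<exists>g\<in>J. \<forall>q\<in>J. \<exists>h. [:int p:] dvd q - h * g"
    using I_p I_add I_mult
    by (intro int_poly_ideal_principal_mod [OF p])
      (auto simp: J_def laurent_of_poly_pCons laurent_of_poly_add laurent_of_poly_mult)
  then obtain g where g: "g \<in> J" "\<And>q. q \<in> J \<Longrightarrow> \<exists>h. [:int p:] dvd q - h * g"
    by blast
  have "\<exists>h. of_nat p dvd x - h * laurent_of_poly g" if "x \<in> I" for x
  proof -
    obtain d q where q: "frag_of (int d) * x = laurent_of_poly q"
      by (rule laurent_of_poly_shifted)
    have "q \<in> J"
      using I_mult [OF that] by (simp add: J_def flip: q)
    then obtain h where "[:int p:] dvd q - h * g"
      using g(2) by blast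
    then have h: "of_nat p dvd laurent_of_poly (q + [:- 1:] * (h * g))"
      by (simp add: laurent_of_poly_dvd_iff)
    \<comment> \<open>The quotient \<open>h\<close> belongs to the shifted element; the factor t^-d
      undoes the shift.\<close>
    define k where "k = frag_of (- int d) * laurent_of_poly h"
    have "frag_of (int d) * k = laurent_of_poly h"
      by (simp add: k_def mult_single flip: mult.assoc)
    then have "laurent_of_poly (q + [:- 1:] * (h * g))
        = frag_of (int d) * (x - k * laurent_of_poly g)"
      by (simp only: laurent_of_poly_add laurent_of_poly_mult laurent_of_poly_pCons
          laurent_of_poly_0 flip: q) (simp add: algebra_simps)
    then show ?thesis
      using h by (auto simp: dvd_single_times_iff)
  qed
  then show ?thesis
    using g(1) unfolding J_def by blast
qed

subsection \<open>Lamp configurations as Laurent polynomials\<close>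

text \<open>Laurent polynomials in \<open>t\<close> with coefficients in \<open>(\<int>/p\<int>)^n\<close>, read as vectors of length \<open>n s\<close>
  over the Laurent polynomials in \<open>t^s\<close>: the entry \<open>r n + j\<close> collects the \<open>j\<close>-th coordinates
  of the coefficients at the exponents congruent to \<open>r\<close> modulo \<open>s\<close>.\<close>

definition laurent_lamp :: "nat \<Rightarrow> nat \<Rightarrow> nat \<Rightarrow> (nat \<Rightarrow> int \<Rightarrow>\<^sub>0 int) \<Rightarrow> int \<Rightarrow> nat \<Rightarrow> int"
  where "laurent_lamp p n s F = (\<lambda>i. \<lambda>j\<in>{..<n}.
    Poly_Mapping.lookup (F (nat (i mod int s) * n + j)) (i div int s) mod int p)"

lemma carrier_lamp_group: "p > 0 \<Longrightarrow> carrier (lamp_group p n) = {..<n} \<rightarrow>\<^sub>E {0..<int p}"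
  by (simp add: lamp_group_def carrier_integer_mod_group)

lemma mult_lamp_group: "x \<otimes>\<^bsub>lamp_group p n\<^esub> y = (\<lambda>j\<in>{..<n}. (x j + y j) mod int p)"
  by (simp add: lamp_group_def)

lemma one_lamp_group: "\<one>\<^bsub>lamp_group p n\<^esub> = (\<lambda>j\<in>{..<n}. 0)"
  by (simp add: lamp_group_def)

lemma comm_group_lamp_sum: "comm_group (lamp_sum p n)"
  by (intro group.group_comm_groupI group_lamp_sum)
    (simp add: mult_lamp_sum mult_lamp_group add.commute)

lemma laurent_lamp_closed:
  assumes "p > 0" "s > 0"
  shows "laurent_lamp p n s F \<in> carrier (lamp_sum p n)"
proof -
  \<comment> \<open>A lit position is q s + r with q an exponent in one of the finitely many entries
    of residue r.\<close>
  have "{i. laurent_lamp p n s F i \<noteq> \<one>\<^bsub>lamp_group p n\<^esub>}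
      \<subseteq> (\<Union>r<s. \<Union>j<n. (\<lambda>q. q * int s + int r) ` Poly_Mapping.keys (F (r * n + j)))"
  proof
    fix i assume "i \<in> {i. laurent_lamp p n s F i \<noteq> \<one>\<^bsub>lamp_group p n\<^esub>}"
    then obtain j where "j < n"
      and "Poly_Mapping.lookup (F (nat (i mod int s) * n + j)) (i div int s) mod int p \<noteq> 0"
      by (auto simp: laurent_lamp_def one_lamp_group restrict_def fun_eq_iff split: if_splits)
    then have "i div int s \<in> Poly_Mapping.keys (F (nat (i mod int s) * n + j))"
      by (auto simp: in_keys_iff)
    moreover have "i = i div int s * int s + int (nat (i mod int s))" "nat (i mod int s) < s"
      using assms(2) by (simp_all add: nat_less_iff)
    ultimately show "i \<in> (\<Union>r<s. \<Union>j<n. (\<lambda>q. q * int s + int r) ` Poly_Mapping.keys (F (r * n + j)))"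
      using \<open>j < n\<close> by blast
  qed
  then have "finite {i. laurent_lamp p n s F i \<noteq> \<one>\<^bsub>lamp_group p n\<^esub>}"
    by (rule finite_subset) auto
  then show ?thesis
    using assms(1) by (auto simp: carrier_lamp_sum carrier_lamp_group laurent_lamp_def)
qed

text \<open>The correspondence of l = r n + j and q with the position i = q s + r and coordinate j
  is bijective, so no coefficient of the first \<open>n * s\<close> entries is lost or counted
  twice.\<close>

lemma laurent_lamp_eq_iff:
  assumes "s > 0"
  shows "laurent_lamp p n s F = laurent_lamp p n s G \<longleftrightarrow> (\<forall>l<n * s. of_nat p dvd F l - G l)"
proof -
  have index: "nat (i mod int s) * n + j < n * s" if "j < n" for i j
  proof -
    have "nat (i mod int s) * n + j < Suc (nat (i mod int s)) * n"
      using that by simp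
    also have "\<dots> \<le> s * n"
      using assms by (intro mult_right_mono Suc_leI) (simp_all add: nat_less_iff)
    finally show ?thesis by (simp add: mult.commute)
  qed
  have "laurent_lamp p n s F = laurent_lamp p n s G \<longleftrightarrow>
      (\<forall>i. \<forall>j<n. int p dvd Poly_Mapping.lookup (F (nat (i mod int s) * n + j)) (i div int s)
        - Poly_Mapping.lookup (G (nat (i mod int s) * n + j)) (i div int s))"
    by (auto simp: laurent_lamp_def fun_eq_iff restrict_def mod_eq_dvd_iff)
  also have "\<dots> \<longleftrightarrow> (\<forall>l<n * s. \<forall>q. int p dvd Poly_Mapping.lookup (F l - G l) q)"
  proof safe
    fix l q
    assume eq: "\<forall>i. \<forall>j<n.
        int p dvd Poly_Mapping.lookup (F (nat (i mod int s) * n + j)) (i div int s)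
        - Poly_Mapping.lookup (G (nat (i mod int s) * n + j)) (i div int s)" and l: "l < n * s"
    then have "n > 0" "l div n < s"
      by (auto simp: less_mult_imp_div_less mult.commute intro: gr0I)
    moreover have "(q * int s + int (l div n)) mod int s = int (l div n)"
      "(q * int s + int (l div n)) div int s = q"
      using \<open>l div n < s\<close> by auto
    ultimately show "int p dvd Poly_Mapping.lookup (F l - G l) q"
      using eq [rule_format, of "l mod n" "q * int s + int (l div n)"]
      by (simp add: lookup_minus)
  qed (use index in \<open>simp add: lookup_minus\<close>)
  finally show ?thesis
    by (simp add: of_nat_dvd_poly_mapping_iff)
qed

lemma laurent_lamp_surj:
  assumes "p > 0" "s > 0" "a \<in> carrier (lamp_sum p n)"
  obtains F where "laurent_lamp p n s F = a"
proof
  \<comment> \<open>The same index correspondence read backwards: r = l div n and j = l mod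
    n.\<close>
  let ?a = "\<lambda>l q. a (q * int s + int (l div n)) (l mod n)"
  \<comment> \<open>For \<open>n = 0\<close> all coordinates of \<open>a\<close> equal
    \<open>undefined\<close>, so their support need not be finite. This case matters for submodules
    of rank zero.\<close>
  have fin: "finite {q. ?a l q \<noteq> 0}" if "n > 0" for l
  proof -
    have "inj (\<lambda>q. q * int s + int (l div n))"
      using assms(2) by (simp add: inj_on_def)
    moreover have "finite {i. a i \<noteq> \<one>\<^bsub>lamp_group p n\<^esub>}"
      using assms(3) by (simp add: carrier_lamp_sum)
    ultimately have "finite ((\<lambda>q. q * int s + int (l div n)) -` {i. a i \<noteq> \<one>\<^bsub>lamp_group p n\<^esub>})"
      by (rule finite_vimageI [rotated])
    then show ?thesis
      by (rule rev_finite_subset) (use that in \<open>auto simp: one_lamp_group\<close>)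
  qed
  have a: "a i \<in> {..<n} \<rightarrow>\<^sub>E {0..<int p}" for i
    using assms(1,3) by (simp add: carrier_lamp_sum carrier_lamp_group)
  have "Poly_Mapping.lookup (Abs_poly_mapping (?a (nat (i mod int s) * n + j))) (i div int s)
      mod int p = a i j" if "j < n" for i j
  proof -
    have "(nat (i mod int s) * n + j) div n = nat (i mod int s)"
      using that by simp
    then have "Poly_Mapping.lookup (Abs_poly_mapping (?a (nat (i mod int s) * n + j))) (i div int s)
        = a i j"
      using that assms(2) fin [of "nat (i mod int s) * n + j"] by simp
    moreover have "a i j \<in> {0..<int p}"
      using PiE_mem [OF a, of j i] that by simp
    ultimately show ?thesis
      by simp
  qed
  then have "laurent_lamp p n s (\<lambda>l. Abs_poly_mapping (?a l)) i j = a i j" for i j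
    using PiE_arb [OF a, of j i] by (cases "j < n") (simp_all add: laurent_lamp_def)
  then show "laurent_lamp p n s (\<lambda>l. Abs_poly_mapping (?a l)) = a"
    by (intro ext)
qed

lemma mult_laurent_lamp:
  "laurent_lamp p n s F \<otimes>\<^bsub>lamp_sum p n\<^esub> laurent_lamp p n s G = laurent_lamp p n s (\<lambda>l. F l + G l)"
  by (auto simp: mult_lamp_sum mult_lamp_group laurent_lamp_def lookup_add mod_add_eq fun_eq_iff)

lemma one_laurent_lamp: "\<one>\<^bsub>lamp_sum p n\<^esub> = laurent_lamp p n s (\<lambda>_. 0)"
  by (simp add: one_lamp_sum one_lamp_group laurent_lamp_def)

text \<open>A shift by a multiple of s preserves residues modulo s, so it only moves exponents
  inside each entry; there \<open>frag_of m\<close> stands for t^(s m).\<close>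

lemma shift_laurent_lamp:
  assumes "s > 0"
  shows "shift (int s * m) (laurent_lamp p n s F) = laurent_lamp p n s (\<lambda>l. frag_of m * F l)"
proof -
  have "(i - int s * m) mod int s = i mod int s" "(i - int s * m) div int s = i div int s - m" for i
    using assms div_mult_self2 [of "int s" i "- m"] mod_mult_self2 [of i "int s" "- m"] by simp_all
  then show ?thesis
    by (simp add: shift_def laurent_lamp_def lookup_frag_of_times)
qed

section \<open>Conjugation and projection in the lamplighter group\<close>

lemma shift_0 [simp]: "shift 0 a = a"
  by (simp add: shift_def)

lemma mult_lamplighter_lamp:
  "(a, 0) \<otimes>\<^bsub>lamplighter p n\<^esub> (b, h) = (a \<otimes>\<^bsub>lamp_sum p n\<^esub> b, h)"
  by (simp add: mult_lamplighter)

lemma inv_laurent_lamp: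
  assumes "p > 0" "s > 0"
  shows "inv\<^bsub>lamplighter p n\<^esub> (laurent_lamp p n s F, 0) = (laurent_lamp p n s (\<lambda>l. - F l), 0)"
  by (rule group.inv_equality [OF group_lamplighter])
    (simp_all add: assms mult_lamplighter_lamp mult_laurent_lamp one_lamplighter carrier_lamplighter
      laurent_lamp_closed flip: one_laurent_lamp)

text \<open>Only \<open>snd x\<close> matters for the conjugation because \<open>\<A>\<^sub>n\<close> is abelian.\<close>

lemma lamplighter_conj:
  assumes "x \<in> carrier (lamplighter p n)" "b \<in> carrier (lamp_sum p n)"
  shows "x \<otimes>\<^bsub>lamplighter p n\<^esub> (b, 0) = (shift (snd x) b, 0) \<otimes>\<^bsub>lamplighter p n\<^esub> x"
proof (cases x)
  case (Pair e t)
  then show ?thesis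
    using assms comm_group.axioms(1) [OF comm_group_lamp_sum, of p n]
    by (simp add: mult_lamplighter carrier_lamplighter shift_in_lamp_sum
        comm_monoid.m_comm)
qed

lemma snd_mult_lamplighter: "snd (x \<otimes>\<^bsub>lamplighter p n\<^esub> y) = snd x + snd y"
  by (cases x; cases y) (simp add: mult_lamplighter)

lemma group_hom_snd_lamplighter: "group_hom (lamplighter p n) integer_group snd"
  using snd_epi_lamplighter [of p n]
  by (simp add: group_hom_def group_hom_axioms_def epi_def)

lemma snd_int_pow_lamplighter:
  assumes "x \<in> carrier (lamplighter p n)"
  shows "snd (x [^]\<^bsub>lamplighter p n\<^esub> (m::int)) = m * snd x"
  using group_hom.hom_int_pow [OF group_hom_snd_lamplighter assms] by simp

lemma snd_inv_lamplighter:
  assumes "x \<in> carrier (lamplighter p n)"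
  shows "snd (inv\<^bsub>lamplighter p n\<^esub> x) = - snd x"
  using group_hom.hom_inv [OF group_hom_snd_lamplighter assms] by simp

subsection \<open>Subgroups\<close>

text \<open>Two of the infinitely many indices must share one of the finitely many right
  cosets.\<close>

lemma (in group) finite_index_pigeonhole:
  assumes "subgroup H G" "finite (rcosets H)" and f: "\<And>i::nat. f i \<in> carrier G"
  obtains i j where "i \<noteq> j" "f i \<otimes> inv f j \<in> H"
proof -
  have "range (\<lambda>i. H #> f i) \<subseteq> rcosets H"
    using f by (auto simp: RCOSETS_def)
  then have "\<not> inj (\<lambda>i. H #> f i)"
    using assms(2) finite_subset range_inj_infinite by blast
  then obtain i j where "i \<noteq> j" "H #> f i = H #> f j"
    by (auto simp: inj_on_def)
  then have "f i \<in> H #> f j"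
    using rcos_self [OF f assms(1)] by metis
  then obtain h where "h \<in> H" "f i = h \<otimes> f j"
    by (auto simp: r_coset_def)
  then have "f i \<otimes> inv f j = h"
    using f subgroup.mem_carrier [OF assms(1)] by (simp add: inv_solve_right')
  then show thesis
    using that \<open>i \<noteq> j\<close> \<open>h \<in> H\<close> by blast
qed

text \<open>Division with remainder by the least positive element; \<open>s = 0\<close> stands for
  the trivial subgroup.\<close>

lemma int_subgroup_range:
  fixes S :: "int set"
  assumes "0 \<in> S" and diff: "\<And>x y. x \<in> S \<Longrightarrow> y \<in> S \<Longrightarrow> x - y \<in> S"
  obtains s :: nat where "S = range (\<lambda>m. int s * m)"
proof (cases "S = {0}")
  case True
  then have "S = range (\<lambda>m. int 0 * m)" by auto
  then show thesis using that by blast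
next
  case False
  have neg: "- x \<in> S" if "x \<in> S" for x
    using diff [OF \<open>0 \<in> S\<close> that] by simp
  obtain x where "x \<in> S" "x \<noteq> 0"
    using False \<open>0 \<in> S\<close> by blast
  then have "\<exists>k>0. int k \<in> S"
    using neg by (intro exI [of _ "nat \<bar>x\<bar>"]) (auto simp: abs_if)
  then obtain s where s: "s > 0" "int s \<in> S" and min: "\<And>k. k > 0 \<Longrightarrow> int k \<in> S \<Longrightarrow> s \<le> k"
    using exists_least_iff [of "\<lambda>k. k > 0 \<and> int k \<in> S"] by (metis not_le)
  have mult_nat: "int s * int k \<in> S" for k
  proof (induction k)
    case (Suc k)
    then show ?case
      using diff [OF Suc neg [OF s(2)]] by (simp add: algebra_simps)
  qed (simp add: \<open>0 \<in> S\<close>)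
  have mult: "int s * m \<in> S" for m
    by (cases m rule: int_cases2) (use mult_nat neg in auto)
  have "x \<in> range (\<lambda>m. int s * m)" if "x \<in> S" for x
  proof -
    have "x mod int s \<in> S"
      using diff [OF that mult [of "x div int s"]] by (simp add: minus_mult_div_eq_mod)
    moreover have "x mod int s < int s" "x mod int s \<ge> 0"
      using s(1) by simp_all
    ultimately have "x mod int s = 0"
      using min [of "nat (x mod int s)"] by (cases "x mod int s = 0") auto
    then show ?thesis
      by (auto elim!: dvdE simp: mod_eq_0_iff_dvd)
  qed
  then show thesis
    using that [of s] mult by blast
qed

text \<open>The rank \<open>k\<close> is obtained once, as the size of a basis; under finite index
  the same \<open>k\<close> is then identified, so both claims of the theorem follow from one
  isomorphism.\<close>

lemma subgroup_lamplighter_iso: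
  assumes p: "Factorial_Ring.prime p" and V: "subgroup V (lamplighter p n)"
    and s: "s > 0" "snd ` V = range (\<lambda>m::int. int s * m)"
  obtains k where "(lamplighter p n)\<lparr>carrier := V\<rparr> \<cong> lamplighter p k"
    "finite (rcosets\<^bsub>lamplighter p n\<^esub> V) \<Longrightarrow> k = n * s"
proof -
  interpret L: group "lamplighter p n" by simp
  have "p > 0"
    using p by (simp add: prime_gt_0_nat)
  note V_carrier = subgroup.mem_carrier [OF V]
  let ?red = "laurent_lamp p n s"
  have red_closed: "?red F \<in> carrier (lamp_sum p n)" for F
    using \<open>p > 0\<close> s(1) by (rule laurent_lamp_closed)
  have lamp_carrier: "(?red F, 0) \<in> carrier (lamplighter p n)" for F
    by (simp add: carrier_lamplighter red_closed)
  have "int s * 1 \<in> snd ` V"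
    using s(2) by blast
  then obtain v where v: "v \<in> V" "snd v = int s"
    by force
  let ?v = "\<lambda>m::int. v [^]\<^bsub>lamplighter p n\<^esub> m"
  have v_pow: "?v m \<in> V" "snd (?v m) = int s * m" for m
    using L.subgroup_int_pow_closed [OF V v(1)] snd_int_pow_lamplighter [OF V_carrier [OF v(1)]] v(2)
    by simp_all
  have conj: "?v m \<otimes>\<^bsub>lamplighter p n\<^esub> (?red F, 0)
      = (?red (\<lambda>l. frag_of m * F l), 0) \<otimes>\<^bsub>lamplighter p n\<^esub> ?v m" for m F
    using lamplighter_conj [OF V_carrier [OF v_pow(1)] red_closed] s(1)
    by (simp add: v_pow(2) shift_laurent_lamp)
  \<comment> \<open>The preimage of the lamp part of \<open>V\<close> among integral vectors; it
    contains all vectors that vanish modulo \<open>p\<close>.\<close>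
  define U where "U = {F. (?red F, 0) \<in> V}"
  have U_mod: "F \<in> U" if "\<forall>l<n * s. of_nat p dvd F l" for F
  proof -
    have "?red F = ?red (\<lambda>_. 0)"
      using that s(1) by (simp add: laurent_lamp_eq_iff)
    then have "(?red F, 0) = \<one>\<^bsub>lamplighter p n\<^esub>"
      by (simp add: one_lamplighter one_laurent_lamp [of p n s])
    then show ?thesis
      using subgroup.one_closed [OF V] by (simp add: U_def)
  qed
  have U_add: "(\<lambda>l. F l + G l) \<in> U" if "F \<in> U" "G \<in> U" for F G
    using subgroup.m_closed [OF V, of "(?red F, 0)" "(?red G, 0)"] that
    by (simp add: U_def mult_lamplighter_lamp mult_laurent_lamp)
  have U_minus: "(\<lambda>l. - F l) \<in> U" if "F \<in> U" for F
    using subgroup.m_inv_closed [OF V, of "(?red F, 0)"] that \<open>p > 0\<close> s(1)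
    by (simp add: U_def inv_laurent_lamp)
  \<comment> \<open>Powers of t^s act by conjugation with powers of \<open>v\<close>, which
    preserves \<open>V\<close>; differences then give all scalars.\<close>
  have U_scale: "(\<lambda>l. c * F l) \<in> U" if F: "F \<in> U" for c F
  proof (induction c rule: frag_induct)
    case zero
    show ?case by (rule U_mod) simp
  next
    case (one m)
    have "(?red (\<lambda>l. frag_of m * F l), 0)
        = ?v m \<otimes>\<^bsub>lamplighter p n\<^esub> (?red F, 0) \<otimes>\<^bsub>lamplighter p n\<^esub> inv\<^bsub>lamplighter p n\<^esub> ?v m"
      by (rule L.inv_solve_right [THEN iffD2])
        (simp_all add: conj V_carrier v_pow(1) lamp_carrier)
    also have "\<dots> \<in> V"
      using F v_pow(1) V by (simp add: U_def subgroup.m_closed subgroup.m_inv_closed)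
    finally show ?case
      by (simp add: U_def)
  next
    case (diff c d)
    then show ?case
      using U_add [OF diff(1) U_minus [OF diff(2)]] by (simp add: left_diff_distrib)
  qed
  have "\<exists>k w. k \<le> n * s \<and> (\<forall>l<k. w l \<in> U) \<and>
    (\<forall>F\<in>U. \<exists>C. \<forall>j<n * s. of_nat p dvd F j - (\<Sum>l<k. C l * w l j)) \<and>
    (\<forall>C. (\<forall>j<n * s. of_nat p dvd (\<Sum>l<k. C l * w l j)) \<longrightarrow> (\<forall>l<k. of_nat p dvd C l)) \<and>
    ((\<forall>i<n * s. \<exists>F\<in>U. \<not> of_nat p dvd F i \<and> (\<forall>j<n * s. j \<noteq> i \<longrightarrow> of_nat p dvd F j))
      \<longrightarrow> k = n * s)"
    by (rule submodule_basis_mod) (fact laurent_prime_dvd_mult [OF p]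
        laurent_ideal_principal_mod [OF p] U_mod U_add U_scale)+
  then obtain k w where w: "\<forall>l<k. w l \<in> U"
    and span: "\<forall>F\<in>U. \<exists>C. \<forall>j<n * s. of_nat p dvd F j - (\<Sum>l<k. C l * w l j)"
    and indep: "\<forall>C. (\<forall>j<n * s. of_nat p dvd (\<Sum>l<k. C l * w l j)) \<longrightarrow> (\<forall>l<k. of_nat p dvd C l)"
    and full: "(\<forall>i<n * s. \<exists>F\<in>U. \<not> of_nat p dvd F i \<and> (\<forall>j<n * s. j \<noteq> i \<longrightarrow> of_nat p dvd F j))
      \<longrightarrow> k = n * s"
    by (elim exE conjE) (rule that)
  define B where "B = (\<lambda>C j. \<Sum>l<k. C l * w l j)"
  have B_add: "B (\<lambda>l. C l + D l) = (\<lambda>j. B C j + B D j)" for C D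
    by (simp add: B_def distrib_right sum.distrib)
  have B_diff: "B (\<lambda>l. C l - D l) j = B C j - B D j" for C D j
    by (simp add: B_def left_diff_distrib sum_subtractf)
  have B_scale: "B (\<lambda>l. c * C l) = (\<lambda>j. c * B C j)" for c C
    by (simp add: B_def sum_distrib_left mult.assoc)
  \<comment> \<open>\<open>B\<close> is well defined and injective modulo \<open>p\<close>, the
    latter by \<open>indep\<close>. The parameter \<open>Suc 0\<close> reads configurations of L_k
    as vectors of length \<open>k\<close> over Laurent polynomials in t itself, so multiplication by
    t on the coefficients corresponds to t^s in \<open>U\<close>.\<close>
  have B_cong: "?red (B C) = ?red (B D) \<longleftrightarrow> laurent_lamp p k (Suc 0) C = laurent_lamp p k (Suc 0) D" for C D
  proof -
    have "of_nat p dvd B (\<lambda>l. C l - D l) j" if "\<forall>l<k. of_nat p dvd C l - D l" for j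
      unfolding B_def using that by (intro dvd_sum) simp
    then have "(\<forall>j<n * s. of_nat p dvd B C j - B D j) \<longleftrightarrow> (\<forall>l<k. of_nat p dvd C l - D l)"
      using spec [OF indep, of "\<lambda>l. C l - D l"] by (auto simp: B_def B_diff [unfolded B_def])
    then show ?thesis
      using s(1) by (simp add: laurent_lamp_eq_iff)
  qed
  have B_in_U: "B C \<in> U" for C
  proof -
    have "(\<lambda>j. \<Sum>l<i. C l * w l j) \<in> U" if "i \<le> k" for i
      using that
    proof (induction i)
      case 0
      show ?case by (rule U_mod) simp
    next
      case (Suc i)
      then show ?case
        using U_add [OF _ U_scale [OF w [rule_format, of i]], of "\<lambda>j. \<Sum>l<i. C l * w l j" "C i"] by simp
    qed
    then show ?thesis
      by (simp add: B_def)
  qed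
  define \<phi> where "\<phi> = (\<lambda>c. ?red (B (SOME C. laurent_lamp p k (Suc 0) C = c)))"
  have \<phi>: "\<phi> (laurent_lamp p k (Suc 0) C) = ?red (B C)" for C
    unfolding \<phi>_def B_cong by (rule someI [of _ C]) (rule refl)
  \<comment> \<open>The generator of the integers in L_k is sent to \<open>v\<close>.\<close>
  define \<psi> where "\<psi> = (\<lambda>(c, m). (\<phi> c, 0) \<otimes>\<^bsub>lamplighter p n\<^esub> ?v m)"
  have \<psi>: "\<psi> (laurent_lamp p k (Suc 0) C, m) = (?red (B C), 0) \<otimes>\<^bsub>lamplighter p n\<^esub> ?v m" for C m
    by (simp add: \<psi>_def \<phi>)
  have lift: "\<exists>C m. x = (laurent_lamp p k (Suc 0) C, m)" if "x \<in> carrier (lamplighter p k)" for x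
    using that \<open>p > 0\<close> by (cases x) (auto simp: carrier_lamplighter elim: laurent_lamp_surj [of p "Suc 0"])
  have snd_\<psi>: "snd (\<psi> (laurent_lamp p k (Suc 0) C, m)) = int s * m" for C m
    by (simp add: \<psi> snd_mult_lamplighter v_pow(2))
  have closed: "\<psi> (laurent_lamp p k (Suc 0) C, m) \<in> V" for C m
    using B_in_U [of C] v_pow(1) by (simp add: \<psi> U_def subgroup.m_closed [OF V])
  have "\<psi> \<in> hom (lamplighter p k) ((lamplighter p n)\<lparr>carrier := V\<rparr>)"
  proof (rule homI)
    show "\<psi> x \<in> carrier ((lamplighter p n)\<lparr>carrier := V\<rparr>)" if "x \<in> carrier (lamplighter p k)" for x
      using lift [OF that] closed by auto
    fix x y assume "x \<in> carrier (lamplighter p k)" "y \<in> carrier (lamplighter p k)"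
    then obtain C m D m' where x: "x = (laurent_lamp p k (Suc 0) C, m)"
      and y: "y = (laurent_lamp p k (Suc 0) D, m')"
      using lift by blast
    have "x \<otimes>\<^bsub>lamplighter p k\<^esub> y = (laurent_lamp p k (Suc 0) (\<lambda>l. C l + frag_of m * D l), m + m')"
      using shift_laurent_lamp [of "Suc 0" m p k D] by (simp add: x y mult_lamplighter mult_laurent_lamp)
    then have "\<psi> (x \<otimes>\<^bsub>lamplighter p k\<^esub> y)
        = (?red (B C), 0) \<otimes>\<^bsub>lamplighter p n\<^esub> (?red (\<lambda>j. frag_of m * B D j), 0)
          \<otimes>\<^bsub>lamplighter p n\<^esub> (?v m \<otimes>\<^bsub>lamplighter p n\<^esub> ?v m')"
      by (simp add: \<psi> B_add B_scale mult_lamplighter_lamp mult_laurent_lamp L.int_pow_mult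
          V_carrier v(1))
    \<comment> \<open>Moving the power of \<open>v\<close> to the left of the second lamp part, by
      \<open>conj\<close>, absorbs the factor \<open>frag_of m\<close>, that is, the twist in the
      product of L_k.\<close>
    also have "\<dots> = (?red (B C), 0) \<otimes>\<^bsub>lamplighter p n\<^esub>
        ((?red (\<lambda>j. frag_of m * B D j), 0) \<otimes>\<^bsub>lamplighter p n\<^esub> ?v m) \<otimes>\<^bsub>lamplighter p n\<^esub> ?v m'"
      by (simp add: L.m_assoc lamp_carrier V_carrier v_pow(1))
    also have "\<dots> = \<psi> x \<otimes>\<^bsub>lamplighter p n\<^esub> \<psi> y"
      by (simp add: x y \<psi> L.m_assoc lamp_carrier V_carrier v_pow(1) flip: conj)
    finally show "\<psi> (x \<otimes>\<^bsub>lamplighter p k\<^esub> y) = \<psi> x \<otimes>\<^bsub>(lamplighter p n)\<lparr>carrier := V\<rparr>\<^esub> \<psi> y"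
      by simp
  qed
  moreover have "bij_betw \<psi> (carrier (lamplighter p k)) (carrier ((lamplighter p n)\<lparr>carrier := V\<rparr>))"
    unfolding bij_betw_def
  proof
    show "inj_on \<psi> (carrier (lamplighter p k))"
    proof (rule inj_onI)
      fix x y assume xy: "x \<in> carrier (lamplighter p k)" "y \<in> carrier (lamplighter p k)" "\<psi> x = \<psi> y"
      then obtain C m D m' where x: "x = (laurent_lamp p k (Suc 0) C, m)"
        and y: "y = (laurent_lamp p k (Suc 0) D, m')"
        using lift by blast
      \<comment> \<open>The projection recovers the exponent because \<open>s > 0\<close>; the power
        of \<open>v\<close> then cancels.\<close>
      have "m = m'"
        using snd_\<psi> [of C m] snd_\<psi> [of D m'] s(1) xy(3) by (simp add: x y)
      then have "?red (B C) = ?red (B D)"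
        using xy(3) by (simp add: x y \<psi> lamp_carrier V_carrier v_pow(1))
      then show "x = y"
        using \<open>m = m'\<close> by (simp add: x y B_cong)
    qed
    have "z \<in> \<psi> ` carrier (lamplighter p k)" if "z \<in> V" for z
    proof -
      have "snd z \<in> range (\<lambda>m. int s * m)"
        using that by (simp flip: s(2))
      then obtain m where m: "snd z = int s * m"
        by (rule rangeE)
      \<comment> \<open>Dividing out the power of \<open>v\<close> with the same projection leaves
        an element of the lamp part, which the basis spans.\<close>
      define y where "y = z \<otimes>\<^bsub>lamplighter p n\<^esub> inv\<^bsub>lamplighter p n\<^esub> ?v m"
      have y: "y \<in> V" "z = y \<otimes>\<^bsub>lamplighter p n\<^esub> ?v m"
        using that v_pow(1) V V_carrier
        by (simp_all add: y_def subgroup.m_closed subgroup.m_inv_closed L.m_assoc)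
      have "snd y = 0"
        by (simp add: y_def snd_mult_lamplighter snd_inv_lamplighter V_carrier v_pow m)
      then obtain a where a: "y = (a, 0)" "a \<in> carrier (lamp_sum p n)"
        using V_carrier [OF y(1)] by (cases y) (simp add: carrier_lamplighter)
      obtain F where F: "?red F = a"
        using laurent_lamp_surj [OF \<open>p > 0\<close> s(1) a(2)] .
      then have "F \<in> U"
        using y(1) a(1) by (simp add: U_def)
      from bspec [OF span this] obtain C where "\<forall>j<n * s. of_nat p dvd F j - B C j"
        unfolding B_def by (rule exE)
      then have "?red F = ?red (B C)"
        using s(1) by (simp add: laurent_lamp_eq_iff)
      then have "z = \<psi> (laurent_lamp p k (Suc 0) C, m)"
        by (simp add: \<psi> y(2) a(1) flip: F)
      then show ?thesis
        using \<open>p > 0\<close> by (simp add: carrier_lamplighter laurent_lamp_closed)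
    qed
    moreover have "\<psi> x \<in> V" if "x \<in> carrier (lamplighter p k)" for x
      using lift [OF that] closed by auto
    ultimately show "\<psi> ` carrier (lamplighter p k) = carrier ((lamplighter p n)\<lparr>carrier := V\<rparr>)"
      by auto
  qed
  ultimately have "lamplighter p k \<cong> (lamplighter p n)\<lparr>carrier := V\<rparr>"
    by (intro is_isoI isoI)
  then have "(lamplighter p n)\<lparr>carrier := V\<rparr> \<cong> lamplighter p k"
    by (rule group.iso_sym [OF group_lamplighter])
  moreover have "k = n * s" if fin: "finite (rcosets\<^bsub>lamplighter p n\<^esub> V)"
  proof (intro mp [OF full] allI impI)
    fix i assume "i < n * s"
    \<comment> \<open>Infinitely many monomials on the \<open>i\<close>-th axis: two of them agree
      modulo \<open>V\<close>, and their difference is an axis vector in \<open>U\<close>.\<close>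
    let ?e = "\<lambda>(m::nat) j. if j = i then frag_of (int m) else 0"
    obtain m m' where m: "m \<noteq> m'"
      "(?red (?e m), 0) \<otimes>\<^bsub>lamplighter p n\<^esub> inv\<^bsub>lamplighter p n\<^esub> (?red (?e m'), 0) \<in> V"
      by (rule L.finite_index_pigeonhole [OF V fin, of "\<lambda>m. (?red (?e m), 0)", OF lamp_carrier])
    let ?F = "\<lambda>j. ?e m j + - ?e m' j"
    have "?F \<in> U"
      using m(2) \<open>p > 0\<close> s(1)
      by (simp add: U_def inv_laurent_lamp mult_lamplighter_lamp mult_laurent_lamp)
    \<comment> \<open>The exponents differ, so this coefficient is exactly 1, which \<open>p\<close>
      does not divide.\<close>
    moreover have "Poly_Mapping.lookup (?F i) (int m) = 1"
      using m(1) by (simp add: lookup_minus lookup_single)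
    then have "\<not> of_nat p dvd ?F i"
      using p by (metis of_nat_dvd_poly_mapping_iff int_dvd_int_iff not_prime_unit of_nat_1)
    ultimately show "\<exists>F\<in>U. \<not> of_nat p dvd F i \<and> (\<forall>j<n * s. j \<noteq> i \<longrightarrow> of_nat p dvd F j)"
      by (intro bexI [of _ ?F]) auto
  qed
  ultimately show thesis
    by (rule that)
qed

theorem theorem3p5:
  fixes p n :: nat and V :: "((int \<Rightarrow> nat \<Rightarrow> int) \<times> int) set"
  assumes "Factorial_Ring.prime p"
    and "n \<ge> 1"
    and "subgroup V (lamplighter p n)"
  shows "(subgroup V ((lamplighter p n)\<lparr>carrier := lamp_subgroup p n\<rparr>) \<or>
          (\<exists>k::nat. (lamplighter p n)\<lparr>carrier := V\<rparr> \<cong> lamplighter p k)) \<and>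
         (finite (rcosets\<^bsub>lamplighter p n\<^esub> V) \<longrightarrow>
          (\<exists>!s::nat. s \<ge> 1 \<and> snd ` V = range (\<lambda>m::int. int s * m)) \<and>
          (\<forall>s::nat. s \<ge> 1 \<and> snd ` V = range (\<lambda>m::int. int s * m) \<longrightarrow>
             (lamplighter p n)\<lparr>carrier := V\<rparr> \<cong> lamplighter p (n * s)))"
proof -
  interpret L: group "lamplighter p n" by simp
  note V = assms(3)
  have diff: "snd (x \<otimes>\<^bsub>lamplighter p n\<^esub> inv\<^bsub>lamplighter p n\<^esub> y) = snd x - snd y"
    if "y \<in> carrier (lamplighter p n)" for x y
    using that by (simp add: snd_mult_lamplighter snd_inv_lamplighter)
  obtain s :: nat where s: "snd ` V = range (\<lambda>m. int s * m)"
  proof (rule int_subgroup_range)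
    show "0 \<in> snd ` V"
      using subgroup.one_closed [OF V] by (force simp: one_lamplighter)
    show "x - y \<in> snd ` V" if xy: "x \<in> snd ` V" "y \<in> snd ` V" for x y
    proof -
      from xy obtain x' y' where x': "x' \<in> V" "x = snd x'" and y': "y' \<in> V" "y = snd y'"
        by (elim imageE)
      have "x' \<otimes>\<^bsub>lamplighter p n\<^esub> inv\<^bsub>lamplighter p n\<^esub> y' \<in> V"
        using x'(1) y'(1) by (intro subgroup.m_closed [OF V] subgroup.m_inv_closed [OF V])
      then have "snd x' - snd y' \<in> snd ` V"
        unfolding diff [OF subgroup.mem_carrier [OF V y'(1)], symmetric] by (rule imageI)
      then show ?thesis
        by (simp only: x'(2) y'(2))
    qed
  qed
  have lamps_or_iso: "subgroup V ((lamplighter p n)\<lparr>carrier := lamp_subgroup p n\<rparr>) \<or>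
      (\<exists>k. (lamplighter p n)\<lparr>carrier := V\<rparr> \<cong> lamplighter p k)"
  proof (cases "s = 0")
    case True
    have "subgroup (lamp_subgroup p n) (lamplighter p n)"
      using group_hom.subgroup_kernel [OF group_hom_snd_lamplighter]
      by (simp add: kernel_snd_lamplighter)
    moreover have "snd x = 0" if "x \<in> V" for x
      using s \<open>s = 0\<close> that by auto
    then have "V \<subseteq> lamp_subgroup p n"
      using subgroup.subset [OF V] by (force simp: lamp_subgroup_def carrier_lamplighter)
    ultimately show ?thesis
      by (intro disjI1 L.subgroup_incl [OF V])
  next
    case False
    then have "s > 0" by simp
    then obtain k where "(lamplighter p n)\<lparr>carrier := V\<rparr> \<cong> lamplighter p k"
      by (rule subgroup_lamplighter_iso [OF assms(1) V _ s])
    then show ?thesis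
      by (intro disjI2 exI)
  qed
  have unique: "\<exists>!s::nat. s \<ge> 1 \<and> snd ` V = range (\<lambda>m::int. int s * m)"
    if fin: "finite (rcosets\<^bsub>lamplighter p n\<^esub> V)"
  proof (rule ex1I [of _ s])
    \<comment> \<open>Among the powers of the shift two lie in the same coset of \<open>V\<close>,
      so the image of \<open>V\<close> contains a nonzero integer and \<open>s\<close> cannot be
      0.\<close>
    have one_carrier: "(\<one>\<^bsub>lamp_sum p n\<^esub>, int m) \<in> carrier (lamplighter p n)" for m
      by (simp add: carrier_lamplighter group.is_monoid monoid.one_closed)
    then obtain i j where ij: "i \<noteq> j" "(\<one>\<^bsub>lamp_sum p n\<^esub>, int i) \<otimes>\<^bsub>lamplighter p n\<^esub>
        inv\<^bsub>lamplighter p n\<^esub> (\<one>\<^bsub>lamp_sum p n\<^esub>, int j) \<in> V"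
      by (rule L.finite_index_pigeonhole [OF V fin, of "\<lambda>m. (\<one>\<^bsub>lamp_sum p n\<^esub>, int m)"])
    then have "int i - int j \<in> snd ` V"
      using imageI [OF ij(2), of snd] by (simp add: diff one_carrier)
    then show "s \<ge> 1 \<and> snd ` V = range (\<lambda>m. int s * m)"
      using s \<open>i \<noteq> j\<close> by (cases "s = 0") auto
    show "t = s" if t: "t \<ge> 1 \<and> snd ` V = range (\<lambda>m. int t * m)" for t
    proof -
      have eq: "range (\<lambda>m. int t * m) = range (\<lambda>m. int s * m)"
        using s t by simp
      \<comment> \<open>Each generator lies in the subgroup generated by the other, so they divide
        each other.\<close>
      have "int s * 1 \<in> range (\<lambda>m. int t * m)" "int t * 1 \<in> range (\<lambda>m. int s * m)"
        unfolding eq by (rule rangeI) (unfold eq [symmetric], rule rangeI)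
      then have "int t dvd int s * 1" "int s dvd int t * 1"
        by (metis dvd_triv_left rangeE)+
      then have "t dvd s" "s dvd t"
        by simp_all
      then show ?thesis
        by (rule dvd_antisym)
    qed
  qed
  have iso: "(lamplighter p n)\<lparr>carrier := V\<rparr> \<cong> lamplighter p (n * t)"
    if "finite (rcosets\<^bsub>lamplighter p n\<^esub> V)"
      and t: "t \<ge> 1 \<and> snd ` V = range (\<lambda>m::int. int t * m)" for t
  proof -
    have "t > 0" "snd ` V = range (\<lambda>m::int. int t * m)"
      using t by simp_all
    from subgroup_lamplighter_iso [OF assms(1) V this] show ?thesis
      using that(1) by metis
  qed
  show ?thesis
    by (intro conjI impI allI lamps_or_iso, erule unique, rule iso)
qed

end
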